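(* Let $m$ be a positive integer. For any oriented graph $D$, we have $$\chi_m(D) \leq \left\lfloor \frac{\Delta(D) - \left\lfloor \frac{\Delta(D)+1}{4m+1} \right\rfloor}{2m} \right\rfloor + 1.$$
   Context: Digraphs are finite, nonempty, without loops and without parallel edges in the same direction. An oriented graph is a digraph in which at most one edge connects any pair of vertices (so there are no directed 2-cycles). $\Delta(D)$ is the maximum total degree (in-degree plus out-degree) of a vertex of $D$. For a positive integer $m$, a digraph is weakly $m$-degenerate if every (nonempty) induced subgraph of it has a vertex whose in-degree or out-degree in that subgraph is strictly less than $m$. $\chi_m(D)$, the $m$-degenerate chromatic number, is the smallest positive integer $k$ such that $V(D)$ can be partitioned into $k$ sets, each of which induces a weakly $m$-degenerate subgraph. *)

theory Defs
  imports
    Complex_Main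
    "HOL-Library.Disjoint_Sets"
    "Graph_Theory.Digraph_Component"
begin

text \<open>
  The locale \<^locale>\<open>digraph\<close> (finite, no loops, no parallel arcs) admits the null graph,
  which is excluded here.
\<close>

locale oriented_graph = digraph +
  assumes verts_nonempty: "verts G \<noteq> {}"
    and at_most_one_arc: "\<lbrakk>e1 \<in> arcs G; e2 \<in> arcs G;
      {tail G e1, head G e1} = {tail G e2, head G e2}\<rbrakk> \<Longrightarrow> e1 = e2"

definition max_degree :: "('a, 'b) pre_digraph \<Rightarrow> nat" where
  "max_degree D = Max ((\<lambda>v. in_degree D v + out_degree D v) ` verts D)"

definition weakly_degenerate :: "nat \<Rightarrow> ('a, 'b) pre_digraph \<Rightarrow> bool" where
  "weakly_degenerate m D \<longleftrightarrow>
    (\<forall>H. induced_subgraph H D \<and> verts H \<noteq> {} \<longrightarrow>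
      (\<exists>v \<in> verts H. in_degree H v < m \<or> out_degree H v < m))"

definition degenerate_partition :: "nat \<Rightarrow> ('a, 'b) pre_digraph \<Rightarrow> 'a set set \<Rightarrow> bool" where
  "degenerate_partition m D P \<longleftrightarrow>
    partition_on (verts D) P \<and> (\<forall>A \<in> P. weakly_degenerate m (induce_subgraph D A))"

definition degenerate_chromatic_number :: "nat \<Rightarrow> ('a, 'b) pre_digraph \<Rightarrow> nat" where
  "degenerate_chromatic_number m D =
    (LEAST k. 0 < k \<and> (\<exists>P. degenerate_partition m D P \<and> card P = k))"

text \<open>
  The minimum is attained: for positive \<open>m\<close> the partition into singletons qualifies.
\<close>

lemma (in oriented_graph) ex_degenerate_partition:
  assumes "0 < m"
  shows "\<exists>k > 0. \<exists>P. degenerate_partition m G P \<and> card P = k"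
proof -
  let ?P = "(\<lambda>v. {v}) ` verts G"
  have "weakly_degenerate m (induce_subgraph G {v})" for v
    unfolding weakly_degenerate_def
  proof (intro allI impI)
    fix H assume H: "induced_subgraph H (induce_subgraph G {v}) \<and> verts H \<noteq> {}"
    then have "arcs H \<subseteq> {e \<in> arcs G. tail G e = v \<and> head G e = v}"
      by (auto simp: induced_subgraph_def)
    then have "arcs H = {}" using no_loops by fastforce
    then have "in_degree H u = 0" for u
      by (simp add: in_degree_def in_arcs_def)
    then show "\<exists>v \<in> verts H. in_degree H v < m \<or> out_degree H v < m"
      using H assms by auto
  qed
  moreover have "partition_on (verts G) ?P"
    by (auto simp: partition_on_def disjoint_def)
  ultimately have "degenerate_partition m G ?P"
    by (auto simp: degenerate_partition_def)
  moreover have "0 < card ?P" using verts_nonempty by (simp add: card_gt_0_iff)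
  ultimately show ?thesis by blast
qed

lemma (in oriented_graph) no_two_cycle: "u \<rightarrow>\<^bsub>G\<^esub> v \<Longrightarrow> \<not> v \<rightarrow>\<^bsub>G\<^esub> u"
proof
  assume "u \<rightarrow>\<^bsub>G\<^esub> v" and "v \<rightarrow>\<^bsub>G\<^esub> u"
  then obtain e1 e2 where
    e: "e1 \<in> arcs G" "tail G e1 = u" "head G e1 = v" "e2 \<in> arcs G" "tail G e2 = v" "head G e2 = u"
    by (metis reachableE)
  then have "e1 = e2" by (intro at_most_one_arc) auto
  with e no_loops[of e1] show False by simp
qed

end

theory Submission
  imports Defs
begin

text \<open>
  The bound combines a Brooks-type theorem with Lovasz's partition of a graph into parts of
  prescribed maximum degree.

  Greedy colouring needs one class per \<open>2 * m\<close> units of degree, because a set of total degree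
  less than \<open>2 * m\<close> is weakly \<open>m\<close>-degenerate. For degree exactly \<open>4 * m\<close> this would give three
  classes; the Brooks-type theorem \<open>two_degenerate_classes\<close> says that for oriented graphs two
  suffice. Each block of \<open>4 * m + 1\<close> units of \<open>\<Delta> + 1\<close> can be split off as a part of maximum
  degree at most \<open>4 * m\<close> (\<open>lovasz_split\<close>) and coloured with two classes. Every such block gains
  one unit of degree over greedy colouring, and the number of blocks is the inner floor of the
  bound (\<open>colourable_bound\<close>).

  For the Brooks-type theorem take a minimal counterexample \<open>V\<close>. Every \<open>V - {v}\<close> has a good
  2-colouring; call \<open>v\<close> its hole. Since neither colour can be given to \<open>v\<close>, and \<open>v\<close> has degree
  at most \<open>4 * m\<close>, the hole has exactly \<open>m\<close> in-neighbours and exactly \<open>m\<close> out-neighbours of each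
  colour (\<open>hole_counts\<close>). Hence giving \<open>v\<close> the colour of a neighbour \<open>u\<close> and making \<open>u\<close> the new
  hole yields another good colouring (\<open>slide_hole\<close>). Slide the hole around an induced cycle that is
  not monochromatic away from the hole. Comparing the counts at a vertex before and after one full
  turn shows that the colours alternate on the \<open>n - 1\<close> coloured vertices, read cyclically, so that
  \<open>n - 1\<close> is even, and that the orientations of the \<open>n\<close> arcs alternate, so that \<open>n\<close> is even. This
  is absurd (\<open>induced_cycle_monochromatic\<close>). Such a cycle always exists: swapping the two colours on
  a component of \<open>V - {v}\<close> preserves goodness, so by the counts some component contains neighbours
  of \<open>v\<close> of both colours, and a shortest path joining two such neighbours closes up to an induced
  cycle through \<open>v\<close>.
\<close>

section \<open>Degenerate sets of an asymmetric relation\<close>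

text \<open>
  Colour classes are subsets of one fixed ground set, so a binary relation together with vertex
  sets replaces digraphs and their induced subgraphs.
\<close>

locale asymmetric_relation =
  fixes E :: "'a \<Rightarrow> 'a \<Rightarrow> bool"
  assumes asym: "E u v \<Longrightarrow> \<not> E v u"
begin

definition preds :: "'a set \<Rightarrow> 'a \<Rightarrow> 'a set" where
  "preds S v = {u \<in> S. E u v}"

definition succs :: "'a set \<Rightarrow> 'a \<Rightarrow> 'a set" where
  "succs S v = {u \<in> S. E v u}"

definition adj :: "'a \<Rightarrow> 'a \<Rightarrow> bool" where
  "adj u v \<longleftrightarrow> E u v \<or> E v u"

definition deg :: "'a set \<Rightarrow> 'a \<Rightarrow> nat" where
  "deg S v = card (preds S v) + card (succs S v)"

definition degenerate :: "nat \<Rightarrow> 'a set \<Rightarrow> bool" where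
  "degenerate m S \<longleftrightarrow>
    (\<forall>T \<subseteq> S. T \<noteq> {} \<longrightarrow> (\<exists>v \<in> T. card (preds T v) < m \<or> card (succs T v) < m))"

lemma irrefl: "\<not> E v v"
  using asym by blast

lemma adj_sym: "adj u v \<longleftrightarrow> adj v u"
  by (auto simp: adj_def)

lemma finite_preds [simp]: "finite S \<Longrightarrow> finite (preds S v)"
  by (simp add: preds_def)

lemma finite_succs [simp]: "finite S \<Longrightarrow> finite (succs S v)"
  by (simp add: succs_def)

lemma preds_mono: "S \<subseteq> T \<Longrightarrow> preds S v \<subseteq> preds T v"
  by (auto simp: preds_def)

lemma succs_mono: "S \<subseteq> T \<Longrightarrow> succs S v \<subseteq> succs T v"
  by (auto simp: succs_def)

lemma deg_insert_self: "deg (insert v S) v = deg S v"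
proof -
  have "preds (insert v S) v = preds S v" "succs (insert v S) v = succs S v"
    using irrefl by (auto simp: preds_def succs_def)
  then show ?thesis by (simp add: deg_def)
qed

lemma deg_mono: "finite T \<Longrightarrow> S \<subseteq> T \<Longrightarrow> deg S v \<le> deg T v"
  unfolding deg_def by (intro add_mono card_mono preds_mono succs_mono) auto

lemma degenerate_mono: "degenerate m T \<Longrightarrow> S \<subseteq> T \<Longrightarrow> degenerate m S"
  unfolding degenerate_def by blast

lemma degenerate_empty [simp]: "degenerate m {}"
  by (simp add: degenerate_def)

text \<open>
  Every nonempty subset either contains \<open>v\<close>, which then has too few neighbours on one side, or
  lies in the degenerate set.
\<close>

lemma degenerate_insert:
  assumes "degenerate m S" "finite S" "card (preds S v) < m \<or> card (succs S v) < m"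
  shows "degenerate m (insert v S)"
  unfolding degenerate_def
proof (intro allI impI)
  fix T assume T: "T \<subseteq> insert v S" "T \<noteq> {}"
  show "\<exists>v \<in> T. card (preds T v) < m \<or> card (succs T v) < m"
  proof (cases "v \<in> T")
    case True
    have "preds T v \<subseteq> preds S v" "succs T v \<subseteq> succs S v"
      using T irrefl by (auto simp: preds_def succs_def)
    then have "card (preds T v) \<le> card (preds S v)" "card (succs T v) \<le> card (succs S v)"
      using assms(2) by (auto intro: card_mono)
    then show ?thesis using True assms(3) by force
  next
    case False
    then show ?thesis using T assms(1) unfolding degenerate_def by blast
  qed
qed

lemma degenerate_Un_unrelated:
  assumes "degenerate m S" "degenerate m T"
    and unrel: "\<And>u w. u \<in> S \<Longrightarrow> w \<in> T \<Longrightarrow> \<not> adj u w"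
  shows "degenerate m (S \<union> T)"
  unfolding degenerate_def
proof (intro allI impI)
  fix X assume X: "X \<subseteq> S \<union> T" "X \<noteq> {}"
  show "\<exists>v \<in> X. card (preds X v) < m \<or> card (succs X v) < m"
  proof (cases "X \<inter> S = {}")
    case True
    then show ?thesis using X assms(2) unfolding degenerate_def by blast
  next
    case False
    then obtain v where v: "v \<in> X \<inter> S"
      "card (preds (X \<inter> S) v) < m \<or> card (succs (X \<inter> S) v) < m"
      using assms(1) unfolding degenerate_def by (meson Int_lower2)
    have "preds X v = preds (X \<inter> S) v" "succs X v = succs (X \<inter> S) v"
      using v(1) X(1) unrel by (auto simp: preds_def succs_def adj_def)
    with v show ?thesis by (metis IntD1)
  qed
qed

lemma degenerate_if_small_deg:
  assumes "finite V" "\<And>v. v \<in> V \<Longrightarrow> deg V v < 2 * m"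
  shows "degenerate m V"
  unfolding degenerate_def
proof (intro allI impI)
  fix T assume T: "T \<subseteq> V" "T \<noteq> {}"
  then obtain v where v: "v \<in> T" by blast
  have "deg T v < 2 * m"
    using deg_mono[OF assms(1) T(1), of v] assms(2)[of v] v T by force
  then show "\<exists>v \<in> T. card (preds T v) < m \<or> card (succs T v) < m"
    using v unfolding deg_def by (intro bexI[of _ v]) auto
qed

end

section \<open>Sliding the hole of a near-colouring\<close>

text \<open>
  The counterexamples to the Brooks-type theorem. Minimality is not part of the locale; it serves
  only to produce a near-colouring, and the aim is to show that none exists.
\<close>

locale two_uncolourable = asymmetric_relation E
  for E :: "'a \<Rightarrow> 'a \<Rightarrow> bool" +
  fixes m :: nat and V :: "'a set"
  assumes m_pos: "0 < m"
    and fin: "finite V"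
    and deg_le: "v \<in> V \<Longrightarrow> deg V v \<le> 4 * m"
    and uncolourable: "\<not> (\<forall>b. degenerate m {w \<in> V. c w = (b :: bool)})"
begin

definition near_colouring :: "('a \<Rightarrow> bool) \<Rightarrow> 'a \<Rightarrow> bool" where
  "near_colouring c v \<longleftrightarrow> v \<in> V \<and> (\<forall>b. degenerate m {w \<in> V - {v}. c w = b})"

text \<open>
  For each of the two colours, fewer than \<open>m\<close> in-neighbours or fewer than \<open>m\<close> out-neighbours would
  allow the hole to take that colour. So all four counts are at least \<open>m\<close>, and their sum is at most
  \<open>4 * m\<close>.
\<close>

lemma hole_counts:
  assumes "near_colouring c v"
  shows "card {u \<in> V. E u v \<and> c u = b} = m" and "card {u \<in> V. E v u \<and> c u = b} = m"
proof -
  let ?S = "\<lambda>b. {w \<in> V - {v}. c w = b}"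
  have vV: "v \<in> V" and dg: "degenerate m (?S b)" for b
    using assms by (auto simp: near_colouring_def)
  have ge: "m \<le> card (preds (?S b) v)" "m \<le> card (succs (?S b) v)" for b
  proof -
    have "\<not> (card (preds (?S b) v) < m \<or> card (succs (?S b) v) < m)"
    proof
      assume "card (preds (?S b) v) < m \<or> card (succs (?S b) v) < m"
      then have ins: "degenerate m (insert v (?S b))"
        using degenerate_insert[OF dg] fin by simp
      have "degenerate m {w \<in> V. (c(v := b)) w = b'}" for b'
      proof (cases "b' = b")
        case True
        then have "{w \<in> V. (c(v := b)) w = b'} = insert v (?S b)" using vV by auto
        then show ?thesis using ins by simp
      next
        case False
        then have "{w \<in> V. (c(v := b)) w = b'} = ?S b'" by auto
        then show ?thesis using dg by simp
      qed
      then show False using uncolourable by blast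
    qed
    then show "m \<le> card (preds (?S b) v)" "m \<le> card (succs (?S b) v)" by auto
  qed
  have p: "preds (?S b) v = {u \<in> V. E u v \<and> c u = b}"
    and s: "succs (?S b) v = {u \<in> V. E v u \<and> c u = b}" for b
    using irrefl by (auto simp: preds_def succs_def)
  have "preds V v = {u \<in> V. E u v \<and> c u = True} \<union> {u \<in> V. E u v \<and> c u = False}"
    and "succs V v = {u \<in> V. E v u \<and> c u = True} \<union> {u \<in> V. E v u \<and> c u = False}"
    by (auto simp: preds_def succs_def)
  then have "card (preds V v)
      = card {u \<in> V. E u v \<and> c u = True} + card {u \<in> V. E u v \<and> c u = False}"
    and "card (succs V v)
      = card {u \<in> V. E v u \<and> c u = True} + card {u \<in> V. E v u \<and> c u = False}"
    using fin by (auto simp: card_Un_disjoint disjoint_iff)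
  then have "card {u \<in> V. E u v \<and> c u = True} + card {u \<in> V. E u v \<and> c u = False}
      + card {u \<in> V. E v u \<and> c u = True} + card {u \<in> V. E v u \<and> c u = False} \<le> 4 * m"
    using deg_le[OF vV] by (simp add: deg_def)
  moreover have "m \<le> card {u \<in> V. E u v \<and> c u = b}" "m \<le> card {u \<in> V. E v u \<and> c u = b}" for b
    using ge[of b] unfolding p s by auto
  note this[of True] this[of False]
  ultimately have "card {u \<in> V. E u v \<and> c u = True} = m" "card {u \<in> V. E u v \<and> c u = False} = m"
    "card {u \<in> V. E v u \<and> c u = True} = m" "card {u \<in> V. E v u \<and> c u = False} = m"
    by linarith+
  then show "card {u \<in> V. E u v \<and> c u = b} = m" "card {u \<in> V. E v u \<and> c u = b} = m"
    by (cases b; simp)+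
qed

text \<open>
  Once \<open>u\<close> is gone, \<open>v\<close> has only \<open>m - 1\<close> neighbours of the colour \<open>c u\<close> on the side of \<open>u\<close>, so
  \<open>v\<close> can be inserted into that class.
\<close>

lemma slide_hole:
  assumes nc: "near_colouring c v" and uV: "u \<in> V" and uv: "adj v u"
  shows "near_colouring (c(v := c u)) u"
  unfolding near_colouring_def
proof (intro conjI allI)
  show "u \<in> V" by fact
  have vV: "v \<in> V" and dg: "degenerate m {w \<in> V - {v}. c w = b}" for b
    using nc by (auto simp: near_colouring_def)
  have neq: "u \<noteq> v" using uv irrefl by (auto simp: adj_def)
  fix b
  show "degenerate m {w \<in> V - {u}. (c(v := c u)) w = b}"
  proof (cases "b = c u")
    case False
    then have "{w \<in> V - {u}. (c(v := c u)) w = b} = {w \<in> V - {v}. c w = b}" by auto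
    then show ?thesis using dg by simp
  next
    case True
    let ?S = "{w \<in> V - {v}. c w = b} - {u}"
    have eq: "{w \<in> V - {u}. (c(v := c u)) w = b} = insert v ?S"
      using True vV neq by auto
    have "card (preds ?S v) < m \<or> card (succs ?S v) < m"
    proof (cases "E u v")
      case E: True
      have "preds ?S v \<subseteq> {w \<in> V. E w v \<and> c w = b}" "u \<notin> preds ?S v"
        unfolding preds_def by blast+
      moreover have "u \<in> {w \<in> V. E w v \<and> c w = b}" using E uV True by blast
      ultimately have "card (preds ?S v) < card {w \<in> V. E w v \<and> c w = b}"
        using fin by (intro psubset_card_mono) auto
      then show ?thesis using hole_counts(1)[OF nc, of b] by linarith
    next
      case False
      then have E: "E v u" using uv by (auto simp: adj_def)
      have "succs ?S v \<subseteq> {w \<in> V. E v w \<and> c w = b}" "u \<notin> succs ?S v"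
        unfolding succs_def by blast+
      moreover have "u \<in> {w \<in> V. E v w \<and> c w = b}" using E uV True by blast
      ultimately have "card (succs ?S v) < card {w \<in> V. E v w \<and> c w = b}"
        using fin by (intro psubset_card_mono) auto
      then show ?thesis using hole_counts(2)[OF nc, of b] by linarith
    qed
    then have "degenerate m (insert v ?S)"
      using fin by (intro degenerate_insert degenerate_mono[OF dg[of b]]) auto
    then show ?thesis using eq by simp
  qed
qed

text \<open>
  The cycle is a sequence \<open>x\<close> of period \<open>n\<close>. Each step of the hole from \<open>x t\<close> to \<open>x (Suc t)\<close> moves
  one colour back by one position, so the colours, read from the position after the hole, are
  cyclically rotated. They form a word of length \<open>k = n - 1\<close>, and when the hole returns to its
  place after \<open>n\<close> steps the word has been rotated by one letter in total. Outside the cycle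
  nothing has changed, and the two cycle neighbours of the hole are its only neighbours on the
  cycle, so \<open>hole_counts\<close> relates consecutive letters of the word.
\<close>

lemma induced_cycle_monochromatic:
  fixes x :: "nat \<Rightarrow> 'a"
  assumes n: "3 \<le> n" and period: "\<And>t. x (t + n) = x t"
    and xV: "\<And>t. x t \<in> V"
    and distinct: "\<And>t j. 0 < j \<Longrightarrow> j < n \<Longrightarrow> x (t + j) \<noteq> x t"
    and edge: "\<And>t. adj (x t) (x (Suc t))"
    and chordless: "\<And>t j. 0 < j \<Longrightarrow> j < n \<Longrightarrow> adj (x t) (x (t + j)) \<Longrightarrow> j = 1 \<or> j = n - 1"
    and nc: "near_colouring c (x 0)"
    and i: "0 < i" "i < n"
  shows "c (x i) = c (x 1)"
proof (rule ccontr)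
  assume bichromatic: "c (x i) \<noteq> c (x 1)"
  define k where "k = n - 1"
  have k: "2 \<le> k" "n = Suc k" using n by (auto simp: k_def)
  \<comment> \<open>The colouring after \<open>t\<close> steps, when the hole is at \<open>x t\<close>.\<close>
  define C where "C = rec_nat c (\<lambda>t d. d(x t := d (x (Suc t))))"
  have C0: "C 0 = c" and CS: "C (Suc t) = (C t)(x t := C t (x (Suc t)))" for t
    by (simp_all add: C_def)
  \<comment> \<open>The word of colours, extended with period \<open>k\<close>: after \<open>t\<close> steps it is read from \<open>b t\<close> on.\<close>
  define b where "b s = c (x (Suc (s mod k)))" for s
  have b_period: "b (s + k) = b s" for s by (simp add: b_def)
  have near: "near_colouring (C t) (x t)" for t
  proof (induction t)
    case (Suc t)
    then show ?case unfolding CS by (rule slide_hole) (rule xV edge)+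
  qed (simp add: C0 nc)
  have on_cycle: "j < k \<Longrightarrow> C t (x (t + Suc j)) = b (t + j)" for t j
  proof (induction t arbitrary: j)
    case 0
    then show ?case by (simp add: C0 b_def)
  next
    case (Suc t)
    show ?case
    proof (cases "Suc j < k")
      case True
      then have "x (t + Suc (Suc j)) \<noteq> x t" using k by (intro distinct) auto
      then show ?thesis using Suc.IH[OF True] by (simp add: CS)
    next
      case False
      then have j: "k = Suc j" using Suc.prems by simp
      have "x (Suc t + Suc j) = x t" using period[of t] j k by simp
      moreover have "b (Suc t + j) = b t" using b_period[of t] j by simp
      moreover have "C t (x (Suc t)) = b t" using Suc.IH[of 0] k by simp
      ultimately show ?thesis by (simp add: CS)
    qed
  qed
  have off_cycle: "u \<notin> range x \<Longrightarrow> C t u = c u" for t u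
    by (induction t) (auto simp: C0 CS)
  have nbr_on_cycle: "\<exists>j. 0 < j \<and> j < n \<and> u = x (t + j)" if "u \<in> range x" "u \<noteq> x t" for u t
  proof -
    obtain s where s: "u = x s" using \<open>u \<in> range x\<close> by blast
    have per: "x (a + q * n) = x a" for a q
    proof (induction q)
      case (Suc q)
      then show ?case using period[of "a + q * n"] by (simp add: algebra_simps)
    qed simp
    define j where "j = (s + t * n - t) mod n"
    have "t \<le> s + t * n" using n by (simp add: trans_le_add2)
    then have "s + t * n = t + j + ((s + t * n - t) div n) * n"
      unfolding j_def using div_mult_mod_eq[of "s + t * n - t" n] by linarith
    then have "u = x (t + j)" using per[of s t] per[of "t + j"] s by metis
    moreover have "j < n" using n by (simp add: j_def)
    moreover have "0 < j" using \<open>u \<noteq> x t\<close> \<open>u = x (t + j)\<close> by (cases j) auto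
    ultimately show ?thesis by blast
  qed
  \<comment> \<open>\<open>Q\<close> stands for being an in-neighbour or an out-neighbour of the hole.\<close>
  have count: "card {u \<in> V. Q u \<and> C t u} = card {u \<in> V. Q u \<and> u \<notin> range x \<and> c u}
      + (of_bool (Q (x (Suc t)) \<and> b t) + of_bool (Q (x (t + k)) \<and> b (t + k - 1)))"
    if Q: "\<And>u. Q u \<Longrightarrow> adj (x t) u" for Q t
  proof -
    let ?R = "{u \<in> V. Q u \<and> u \<notin> range x \<and> c u}"
    let ?A = "{u \<in> {x (Suc t)}. Q u \<and> b t}" and ?B = "{u \<in> {x (t + k)}. Q u \<and> b (t + k - 1)}"
    have cA: "C t (x (Suc t)) = b t" using on_cycle[of 0 t] k by simp
    have cB: "C t (x (t + k)) = b (t + k - 1)"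
      using on_cycle[of "k - 1" t] k by (simp add: Suc_diff_le)
    have AB: "x (t + k) \<noteq> x (Suc t)"
      using distinct[of "k - 1" "Suc t"] k by (simp add: Suc_diff_le)
    have "{u \<in> V. Q u \<and> C t u} = ?R \<union> (?A \<union> ?B)"
    proof (intro equalityI subsetI)
      fix u assume u: "u \<in> {u \<in> V. Q u \<and> C t u}"
      show "u \<in> ?R \<union> (?A \<union> ?B)"
      proof (cases "u \<in> range x")
        case False
        then show ?thesis using u off_cycle by auto
      next
        case True
        have "adj (x t) u" using u Q by blast
        then have "u \<noteq> x t" using irrefl by (auto simp: adj_def)
        then obtain j where j: "0 < j" "j < n" "u = x (t + j)" using nbr_on_cycle True by blast
        then have "j = 1 \<or> j = k" using chordless \<open>adj (x t) u\<close> k_def by blast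
        then show ?thesis using u j cA cB by auto
      qed
    next
      fix u assume "u \<in> ?R \<union> (?A \<union> ?B)"
      then show "u \<in> {u \<in> V. Q u \<and> C t u}" using xV cA cB off_cycle by auto
    qed
    moreover have "card (?R \<union> (?A \<union> ?B)) = card ?R + (card ?A + card ?B)"
      using fin AB by (subst card_Un_disjoint; (subst card_Un_disjoint)?) auto
    moreover have "card ?A = of_bool (Q (x (Suc t)) \<and> b t)"
      by (cases "Q (x (Suc t)) \<and> b t") (auto simp: card_1_singleton_iff)
    moreover have "card ?B = of_bool (Q (x (t + k)) \<and> b (t + k - 1))"
      by (cases "Q (x (t + k)) \<and> b (t + k - 1)") (auto simp: card_1_singleton_iff)
    ultimately show ?thesis by simp
  qed
  \<comment> \<open>The counts at the vertex \<open>x (t + 1)\<close> at times \<open>t + 1\<close> and \<open>t + 1 + n\<close> agree, and the off-cycle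
      contribution cancels.\<close>
  have balance: "of_bool (Q (x (t + 2)) \<and> b (t + 1)) + of_bool (Q (x t) \<and> b t)
      = (of_bool (Q (x (t + 2)) \<and> b (t + 2)) + of_bool (Q (x t) \<and> b (t + 1)) :: nat)"
    if Q: "Q = (\<lambda>u. E u (x (t + 1))) \<or> Q = (\<lambda>u. E (x (t + 1)) u)" for Q t
  proof -
    have hole: "x (t + 1 + n) = x (t + 1)" "x (t + 1 + k) = x t" "x (t + 1 + n + k) = x t"
      "x (Suc (t + 1 + n)) = x (t + 2)"
      using period[of "t + 1"] period[of t] period[of "t + n"] period[of "t + 2"] k
      by (simp_all add: algebra_simps)
    have b: "b (t + 1 + n) = b (t + 2)" "b (t + 1 + k - 1) = b t" "b (t + 1 + n + k - 1) = b (t + 1)"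
      using b_period[of "t + 2"] b_period[of t] b_period[of "t + 1"] b_period[of "t + 1 + k"] k
      by (simp_all add: algebra_simps)
    have c1: "card {u \<in> V. Q u \<and> C s u} = m" if "x s = x (t + 1)" for s
      using hole_counts[OF near[of s], of True] Q that by auto
    have "card {u \<in> V. Q u \<and> C (t + 1) u} = card {u \<in> V. Q u \<and> C (t + 1 + n) u}"
      using c1[of "t + 1"] c1[of "t + 1 + n"] hole(1) by simp
    moreover have "\<And>u. Q u \<Longrightarrow> adj (x (t + 1)) u" using Q by (auto simp: adj_def)
    ultimately show ?thesis
      using count[of Q "t + 1"] count[of Q "t + 1 + n"] hole b by simp
  qed
  define fwd where "fwd t = E (x t) (x (Suc t))" for t
  have fwd_neg: "E (x (Suc t)) (x t) \<longleftrightarrow> \<not> fwd t" for t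
    using edge[of t] asym by (auto simp: fwd_def adj_def)
  \<comment> \<open>If both cycle neighbours of \<open>x (t + 1)\<close> lie on the same side, the two colours seen there are
      the same as a multiset one turn later; if they lie on different sides, each is unchanged.\<close>
  have step: "b (t + 2) = b t \<and> (fwd (t + 1) = fwd t \<longrightarrow> b (t + 1) = b t)" for t
  proof -
    have e: "E (x t) (x (t + 1)) = fwd t" "E (x (t + 1)) (x t) = (\<not> fwd t)"
      "E (x (t + 1)) (x (t + 2)) = fwd (t + 1)" "E (x (t + 2)) (x (t + 1)) = (\<not> fwd (t + 1))"
      using fwd_neg[of t] fwd_neg[of "t + 1"] by (simp_all add: fwd_def)
    have "of_bool (\<not> fwd (t + 1) \<and> b (t + 1)) + of_bool (fwd t \<and> b t)
        = (of_bool (\<not> fwd (t + 1) \<and> b (t + 2)) + of_bool (fwd t \<and> b (t + 1)) :: nat)"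
      using balance[of "\<lambda>u. E u (x (t + 1))" t, OF disjI1[OF refl]] unfolding e .
    moreover have "of_bool (fwd (t + 1) \<and> b (t + 1)) + of_bool (\<not> fwd t \<and> b t)
        = (of_bool (fwd (t + 1) \<and> b (t + 2)) + of_bool (\<not> fwd t \<and> b (t + 1)) :: nat)"
      using balance[of "\<lambda>u. E (x (t + 1)) u" t, OF disjI2[OF refl]] unfolding e .
    ultimately show ?thesis by (auto simp: of_bool_def split: if_splits)
  qed
  have parity: "b t = b (t mod 2)" for t
  proof (induction t rule: less_induct)
    case (less t)
    show ?case
    proof (cases "t < 2")
      case False
      then have "b t = b (t - 2)" using step[of "t - 2"] by (metis le_add_diff_inverse2 not_less)
      also have "\<dots> = b ((t - 2) mod 2)" using False by (intro less) simp
      also have "(t - 2) mod 2 = t mod 2" using False by (simp add: le_mod_geq)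
      finally show ?thesis .
    qed simp
  qed
  have "b (i - 1) \<noteq> b 0" using bichromatic i k by (simp add: b_def)
  then have b01: "b 1 \<noteq> b 0" using parity[of "i - 1"] by (metis mod2_eq_if)
  have b_alt: "b (t + 1) \<noteq> b t" for t
    using parity[of t] parity[of "t + 1"] b01 by (cases "even t") (auto simp: mod2_eq_if)
  have fwd_alt: "fwd t = (fwd 0 = even t)" for t
    by (induction t) (use step b_alt in auto)
  have "even k"
    using b_period[of 0] parity[of k] b01 by (auto simp: mod2_eq_if split: if_splits)
  moreover have "even n"
    using fwd_alt[of n] period[of 0] period[of 1] by (auto simp: fwd_def)
  ultimately show False using k by simp
qed

text \<open>
  A walk in \<open>V - {v}\<close> between two neighbours of \<open>v\<close> of different colours, of minimal length among
  all such walks, has no repeated vertex, no chord, and no neighbour of \<open>v\<close> in its interior, since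
  any of these would give a shorter one. Together with \<open>v\<close> it is therefore an induced cycle,
  contrary to the previous lemma.
\<close>

lemma closed_walk_monochromatic_ends:
  assumes nc: "near_colouring c v"
    and p: "\<And>i. i \<le> l \<Longrightarrow> p i \<in> V - {v}" "\<And>i. i < l \<Longrightarrow> adj (p i) (p (Suc i))"
      "adj v (p 0)" "adj v (p l)"
  shows "c (p 0) = c (p l)"
proof (rule ccontr)
  assume bichromatic: "c (p 0) \<noteq> c (p l)"
  define W where "W l p \<longleftrightarrow> (\<forall>i\<le>l. p i \<in> V - {v}) \<and> (\<forall>i<l. adj (p i) (p (Suc i)))
     \<and> adj v (p 0) \<and> adj v (p l) \<and> c (p 0) \<noteq> c (p l)" for l and p :: "nat \<Rightarrow> 'a"
  have "\<exists>l p. W l p" using p bichromatic unfolding W_def by blast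
  then obtain l where "\<exists>p. W l p" and least: "\<And>l'. l' < l \<Longrightarrow> \<nexists>p. W l' p"
    using exists_least_iff[of "\<lambda>l. \<exists>p. W l p"] by blast
  then obtain p where W: "W l p" by blast
  then have pV: "\<And>i. i \<le> l \<Longrightarrow> p i \<in> V" "\<And>i. i \<le> l \<Longrightarrow> p i \<noteq> v"
    and pE: "\<And>i. i < l \<Longrightarrow> adj (p i) (p (Suc i))"
    and ends: "adj v (p 0)" "adj v (p l)" and ne: "c (p 0) \<noteq> c (p l)"
    unfolding W_def by auto
  have inj: "p i \<noteq> p j" if ij: "i < j" "j \<le> l" for i j
  proof
    assume eq: "p i = p j"
    \<comment> \<open>Cut out the closed subwalk from \<open>i\<close> to \<open>j\<close>.\<close>
    define q where "q r = (if r \<le> i then p r else p (r + (j - i)))" for r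
    have "W (l - (j - i)) q"
      unfolding W_def
    proof (intro conjI allI impI)
      show "q r \<in> V - {v}" if "r \<le> l - (j - i)" for r
        using that ij pV by (auto simp: q_def)
      show "adj (q r) (q (Suc r))" if "r < l - (j - i)" for r
      proof -
        consider "r < i" | "r = i" | "r > i" by linarith
        then show ?thesis
          using that ij eq pE[of r] pE[of "r + (j - i)"] pE[of j] by cases (auto simp: q_def)
      qed
      have q0: "q 0 = p 0" by (simp add: q_def)
      have ql: "q (l - (j - i)) = p l"
      proof (cases "j = l")
        case True
        then show ?thesis using ij eq by (simp add: q_def)
      next
        case False
        then show ?thesis using ij by (auto simp: q_def)
      qed
      show "adj v (q 0)" "adj v (q (l - (j - i)))" "c (q 0) \<noteq> c (q (l - (j - i)))"
        using q0 ql ends ne by simp_all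
    qed
    then show False using least[of "l - (j - i)"] ij by auto
  qed
  have chord: "j = Suc i" if ij: "i < j" "j \<le> l" and eq: "adj (p i) (p j)" for i j
  proof (rule ccontr)
    assume nj: "j \<noteq> Suc i"
    define d where "d = j - Suc i"
    have d: "0 < d" "j = Suc i + d" using nj ij by (auto simp: d_def)
    \<comment> \<open>Replace the subwalk from \<open>i\<close> to \<open>j\<close> by the chord.\<close>
    define q where "q r = (if r \<le> i then p r else p (r + d))" for r
    have "W (l - d) q"
      unfolding W_def
    proof (intro conjI allI impI)
      show "q r \<in> V - {v}" if "r \<le> l - d" for r
        using that ij d pV by (auto simp: q_def)
      show "adj (q r) (q (Suc r))" if "r < l - d" for r
      proof -
        consider "r < i" | "r = i" | "r > i" by linarith
        then show ?thesis
          using that ij d eq pE[of r] pE[of "r + d"] by cases (auto simp: q_def)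
      qed
      show "adj v (q 0)" "adj v (q (l - d))" "c (q 0) \<noteq> c (q (l - d))"
        using d ij ends ne by (auto simp: q_def)
    qed
    then show False using least[of "l - d"] d ij by auto
  qed
  have spoke: "i = 0 \<or> i = l" if il: "i \<le> l" and av: "adj v (p i)" for i
  proof (rule ccontr)
    assume "\<not> (i = 0 \<or> i = l)"
    then have i: "0 < i" "i < l" using il by auto
    \<comment> \<open>The colour of \<open>p i\<close> differs from that of one of the two ends.\<close>
    show False
    proof (cases "c (p i) = c (p 0)")
      case False
      then have "W i p" using i av pV pE ends by (auto simp: W_def)
      then show False using least i by blast
    next
      case True
      then have "W (l - i) (\<lambda>r. p (r + i))" using i av pV pE ends ne by (auto simp: W_def)
      then show False using least[of "l - i"] i by auto
    qed
  qed
  have l: "0 < l" using ne by (cases l) auto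
  \<comment> \<open>The periodic parametrisation of the cycle, with the hole \<open>v\<close> at position 0.\<close>
  define n where "n = l + 2"
  define y where "y s = (if s = 0 then v else p (s - 1))" for s
  define x where "x t = y (t mod n)" for t
  have y_inj: "y s \<noteq> y t" if "s < t" "t < n" for s t
  proof -
    have "t - 1 \<le> l" "0 < t" using that by (auto simp: n_def)
    then show ?thesis using that(1) inj[of "s - 1" "t - 1"] pV(2)[of "t - 1"]
      by (auto simp: y_def)
  qed
  have y_adj: "t = Suc s \<or> s = 0 \<and> t = n - 1" if "s < t" "t < n" "adj (y s) (y t)" for s t
  proof -
    have t: "t - 1 \<le> l" "0 < t" using that by (auto simp: n_def)
    show ?thesis
    proof (cases "s = 0")
      case True
      then have "t - 1 = 0 \<or> t - 1 = l" using that(3) t spoke[of "t - 1"] by (simp add: y_def)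
      then show ?thesis using True t by (auto simp: n_def)
    next
      case False
      then have "t - 1 = Suc (s - 1)"
        using that t chord[of "s - 1" "t - 1"] by (simp add: y_def)
      then show ?thesis using False t by simp
    qed
  qed
  have vV: "v \<in> V" using nc by (simp add: near_colouring_def)
  have lt: "t mod n < n" for t by (simp add: n_def)
  have shift: "(t + j) mod n = (if t mod n + j < n then t mod n + j else t mod n + j - n)"
    if "j < n" for t j
  proof -
    have "(t + j) mod n = (t mod n + j) mod n" by (simp add: mod_simps)
    moreover have "t mod n + j - n < n"
      using that lt[of t] by linarith
    ultimately show ?thesis by (simp add: le_mod_geq)
  qed
  have "c (x (l + 1)) = c (x 1)"
  proof (rule induced_cycle_monochromatic[where n = n])
    show "3 \<le> n" using l by (simp add: n_def)
    show "x (t + n) = x t" for t by (simp add: x_def)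
    show "x t \<in> V" for t
    proof -
      have "t mod n - 1 \<le> l" using lt[of t] unfolding n_def by linarith
      then show ?thesis using vV pV(1)[of "t mod n - 1"] by (simp add: x_def y_def)
    qed
    show "x (t + j) \<noteq> x t" if "0 < j" "j < n" for t j
    proof (cases "t mod n + j < n")
      case True
      then show ?thesis
        using that y_inj[of "t mod n" "t mod n + j"] by (simp add: x_def shift)
    next
      case False
      then show ?thesis
        using that lt[of t] y_inj[of "t mod n + j - n" "t mod n"] by (simp add: x_def shift)
    qed
    show "adj (x t) (x (Suc t))" for t
    proof -
      have s: "Suc t mod n = (if Suc (t mod n) < n then Suc (t mod n) else 0)"
        using shift[of 1 t] lt[of t] l by (auto simp: n_def)
      have next_x: "x (Suc t) = y (if Suc (t mod n) < n then Suc (t mod n) else 0)"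
        by (simp only: x_def s)
      consider "t mod n = 0" | "t mod n = l + 1" | "0 < t mod n" "t mod n < l + 1"
        using lt[of t] unfolding n_def by linarith
      then show ?thesis
      proof cases
        case 1
        then have "x t = v" by (simp add: x_def y_def)
        moreover have "x (Suc t) = p 0" unfolding next_x 1 by (simp add: y_def n_def)
        ultimately show ?thesis using ends by simp
      next
        case 2
        then have "x t = p l" by (simp add: x_def y_def)
        moreover have "x (Suc t) = v" unfolding next_x 2 by (simp add: y_def n_def)
        ultimately show ?thesis using ends adj_sym by simp
      next
        case 3
        then have "x t = p (t mod n - 1)" by (simp add: x_def y_def)
        moreover have "x (Suc t) = p (Suc (t mod n - 1))"
          unfolding next_x using 3 by (simp add: y_def n_def)
        moreover have "t mod n - 1 < l" using 3 by linarith
        ultimately show ?thesis using pE by simp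
      qed
    qed
    show "j = 1 \<or> j = n - 1" if "0 < j" "j < n" "adj (x t) (x (t + j))" for t j
    proof (cases "t mod n + j < n")
      case True
      then have "adj (y (t mod n)) (y (t mod n + j))" using that by (simp add: x_def shift)
      then show ?thesis using y_adj[of "t mod n" "t mod n + j"] that True by auto
    next
      case False
      then have "adj (y (t mod n + j - n)) (y (t mod n))"
        using that adj_sym by (simp add: x_def shift)
      then show ?thesis using y_adj[of "t mod n + j - n" "t mod n"] that False lt[of t] by linarith
    qed
    show "near_colouring c (x 0)" using nc by (simp add: x_def y_def)
  qed (use l in \<open>auto simp: n_def\<close>)
  then show False using ne by (simp add: x_def y_def n_def)
qed

text \<open>
  \<open>K\<close> is a union of components of \<open>V - {v}\<close>, so the new colour classes are disjoint unions of
  mutually unrelated pieces of the old ones.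
\<close>

lemma swap_component:
  assumes nc: "near_colouring c v"
    and closed: "\<And>u w. u \<in> K \<Longrightarrow> w \<in> V - {v} \<Longrightarrow> adj u w \<Longrightarrow> w \<in> K"
  shows "near_colouring (\<lambda>w. if w \<in> K then \<not> c w else c w) v"
  unfolding near_colouring_def
proof (intro conjI allI)
  show "v \<in> V" using nc by (simp add: near_colouring_def)
  have dg: "degenerate m {w \<in> V - {v}. c w = b}" for b
    using nc by (auto simp: near_colouring_def)
  fix b
  have "degenerate m ({w \<in> V - {v}. w \<in> K \<and> c w = (\<not> b)} \<union> {w \<in> V - {v}. w \<notin> K \<and> c w = b})"
    using closed
    by (intro degenerate_Un_unrelated degenerate_mono[OF dg[of b]] degenerate_mono[OF dg[of "\<not> b"]])
      auto
  moreover have "{w \<in> V - {v}. w \<in> K \<and> c w = (\<not> b)} \<union> {w \<in> V - {v}. w \<notin> K \<and> c w = b}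
      = {w \<in> V - {v}. (if w \<in> K then \<not> c w else c w) = b}" by auto
  ultimately show "degenerate m {w \<in> V - {v}. (if w \<in> K then \<not> c w else c w) = b}" by simp
qed

text \<open>
  In the component of a neighbour \<open>u\<close> of the hole there is a neighbour of the other colour:
  otherwise swapping colours there would lower the number of in-neighbours of the colour of \<open>u\<close>
  below \<open>m\<close>.
\<close>

lemma no_near_colouring: "\<not> near_colouring c v"
proof
  assume nc: "near_colouring c v"
  have "card {u \<in> V. E u v \<and> c u = True} \<noteq> 0"
    using hole_counts(1)[OF nc, of True] m_pos by linarith
  then have "{u \<in> V. E u v \<and> c u = True} \<noteq> {}" by (metis card.empty)
  then obtain u where u: "u \<in> V" "E u v" "c u" by blast
  define R where "R = {(a, b). a \<in> V - {v} \<and> b \<in> V - {v} \<and> adj a b}"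
  define K where "K = R\<^sup>* `` {u}"
  have uV: "u \<in> V - {v}" using u irrefl by auto
  have uK: "u \<in> K" by (simp add: K_def)
  have KV: "K \<subseteq> V - {v}"
  proof
    fix w assume "w \<in> K"
    then have "(u, w) \<in> R\<^sup>*" by (simp add: K_def)
    then show "w \<in> V - {v}" using uV by (induction) (auto simp: R_def)
  qed
  have closed: "w \<in> K" if "a \<in> K" "w \<in> V - {v}" "adj a w" for a w
  proof -
    have "(a, w) \<in> R" using that KV by (auto simp: R_def)
    then show ?thesis using that(1) by (auto simp: K_def intro: rtrancl_into_rtrancl)
  qed
  have "\<exists>w \<in> K. adj v w \<and> \<not> c w"
  proof (rule ccontr)
    assume "\<not> ?thesis"
    then have all: "\<And>w. w \<in> K \<Longrightarrow> adj v w \<Longrightarrow> c w" by blast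
    let ?c = "\<lambda>w. if w \<in> K then \<not> c w else c w"
    have "near_colouring ?c v" by (rule swap_component[OF nc closed])
    then have same: "card {w \<in> V. E w v \<and> ?c w = True} = card {w \<in> V. E w v \<and> c w = True}"
      using hole_counts(1)[OF nc, of True] hole_counts(1)[of ?c v True] by (simp only:)
    have sub: "{w \<in> V. E w v \<and> ?c w = True} \<subseteq> {w \<in> V. E w v \<and> c w = True}"
    proof
      fix w assume w: "w \<in> {w \<in> V. E w v \<and> ?c w = True}"
      then have "c w" using all[of w] by (cases "w \<in> K") (auto simp: adj_def)
      then show "w \<in> {w \<in> V. E w v \<and> c w = True}" using w by blast
    qed
    have "finite {w \<in> V. E w v \<and> c w = True}" using fin by simp
    from card_subset_eq[OF this sub same]
    have "u \<in> {w \<in> V. E w v \<and> ?c w = True} \<longleftrightarrow> u \<in> {w \<in> V. E w v \<and> c w = True}" by (rule arg_cong)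
    then show False using u uK by simp
  qed
  then obtain w where w: "w \<in> K" "adj v w" "\<not> c w" by blast
  then obtain l where "(u, w) \<in> R ^^ l" by (auto simp: K_def rtrancl_power)
  then obtain p where p: "p 0 = u" "p l = w" "\<And>i. i < l \<Longrightarrow> (p i, p (Suc i)) \<in> R"
    by (auto simp: relpow_fun_conv)
  have "p i \<in> V - {v}" if "i \<le> l" for i
    using that p KV w by (cases "i = l") (auto simp: R_def)
  then have "c (p 0) = c (p l)"
    using p u w by (intro closed_walk_monochromatic_ends[OF nc]) (auto simp: R_def adj_def)
  then show False using p u w by simp
qed

end

section \<open>Two classes for total degree at most \<open>4 * m\<close>\<close>

context asymmetric_relation
begin

text \<open>
  Asymmetry cannot be dropped: for \<open>m = 1\<close>, three vertices joined pairwise in both directions have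
  degree 4, and no two of them lie in a common degenerate set.
\<close>

theorem two_degenerate_classes:
  assumes "0 < m" "finite V" "\<And>v. v \<in> V \<Longrightarrow> deg V v \<le> 4 * m"
  shows "\<exists>c. \<forall>b :: bool. degenerate m {w \<in> V. c w = b}"
  using assms(2,3)
proof (induction V rule: finite_psubset_induct)
  case (psubset V)
  show ?case
  proof (cases "V = {}")
    case False
    then obtain v where v: "v \<in> V" by blast
    have "\<exists>c. \<forall>b :: bool. degenerate m {w \<in> V - {v}. c w = b}"
    proof (rule psubset.IH)
      show "V - {v} \<subset> V" using v by blast
      show "deg (V - {v}) w \<le> 4 * m" if "w \<in> V - {v}" for w
        using that psubset.prems[of w] deg_mono[OF psubset.hyps, of "V - {v}" w] by force
    qed
    then obtain c where c: "\<And>b :: bool. degenerate m {w \<in> V - {v}. c w = b}" by blast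
    show ?thesis
    proof (rule ccontr)
      assume "\<not> ?thesis"
      then interpret two_uncolourable E m V
        using assms(1) psubset.hyps psubset.prems by unfold_locales auto
      show False using no_near_colouring[of c v] c v by (simp add: near_colouring_def)
    qed
  qed simp
qed

section \<open>Splitting off parts of bounded degree\<close>

lemma deg_Un_disjoint:
  assumes "finite A" "finite B" "A \<inter> B = {}"
  shows "deg (A \<union> B) v = deg A v + deg B v"
proof -
  have "preds (A \<union> B) v = preds A v \<union> preds B v" "succs (A \<union> B) v = succs A v \<union> succs B v"
    "preds A v \<inter> preds B v = {}" "succs A v \<inter> succs B v = {}"
    using assms(3) by (auto simp: preds_def succs_def)
  then show ?thesis using assms by (simp add: deg_def card_Un_disjoint)
qed

definition arc_count :: "'a set \<Rightarrow> nat" where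
  "arc_count A = card {(u, w). u \<in> A \<and> w \<in> A \<and> E u w}"

lemma arc_count_insert:
  assumes "finite A" "v \<notin> A"
  shows "arc_count (insert v A) = arc_count A + deg A v"
proof -
  let ?e = "{(u, w). u \<in> A \<and> w \<in> A \<and> E u w}"
  have "{(u, w). u \<in> insert v A \<and> w \<in> insert v A \<and> E u w}
      = ?e \<union> ((\<lambda>u. (u, v)) ` preds A v \<union> (\<lambda>w. (v, w)) ` succs A v)"
    using irrefl by (auto simp: preds_def succs_def)
  moreover have fe: "finite ?e" by (rule finite_subset[of _ "A \<times> A"]) (use assms in auto)
  moreover have "?e \<inter> ((\<lambda>u. (u, v)) ` preds A v \<union> (\<lambda>w. (v, w)) ` succs A v) = {}"
    "(\<lambda>u. (u, v)) ` preds A v \<inter> (\<lambda>w. (v, w)) ` succs A v = {}"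
    using assms by (auto simp: preds_def succs_def)
  ultimately have "arc_count (insert v A) = card ?e
      + (card ((\<lambda>u. (u, v)) ` preds A v) + card ((\<lambda>w. (v, w)) ` succs A v))"
    using assms by (simp add: arc_count_def card_Un_disjoint)
  moreover have "card ((\<lambda>u. (u, v)) ` preds A v) = card (preds A v)"
    "card ((\<lambda>w. (v, w)) ` succs A v) = card (succs A v)"
    by (auto intro!: card_image inj_onI)
  ultimately show ?thesis by (simp add: arc_count_def deg_def)
qed

text \<open>
  The weights on the sizes of the two parts are what makes a misplaced vertex profitable to move:
  moving \<open>v\<close> from \<open>A\<close> to \<open>B\<close> changes the cost by
  \<open>deg B v - deg A v + d\<^sub>1 - d\<^sub>2\<close>.
\<close>

definition split_cost :: "nat \<Rightarrow> nat \<Rightarrow> 'a set \<Rightarrow> 'a set \<Rightarrow> int" where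
  "split_cost d\<^sub>1 d\<^sub>2 A B =
    int (arc_count A) + int (arc_count B) - int d\<^sub>1 * int (card A) - int d\<^sub>2 * int (card B)"

lemma split_cost_commute: "split_cost d\<^sub>1 d\<^sub>2 A B = split_cost d\<^sub>2 d\<^sub>1 B A"
  by (simp add: split_cost_def)

lemma deg_le_if_move_no_gain:
  assumes fin: "finite A" "finite B" "A \<inter> B = {}" and v: "v \<in> A"
    and dl: "deg (A \<union> B) v \<le> d\<^sub>1 + d\<^sub>2 + 1"
    and no_gain: "split_cost d\<^sub>1 d\<^sub>2 A B \<le> split_cost d\<^sub>1 d\<^sub>2 (A - {v}) (insert v B)"
  shows "deg A v \<le> d\<^sub>1"
proof -
  define A' where "A' = A - {v}"
  have A': "A = insert v A'" "v \<notin> A'" "finite A'" "v \<notin> B"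
    using v fin by (auto simp: A'_def)
  have arcs: "arc_count A = arc_count A' + deg A' v" "arc_count (insert v B) = arc_count B + deg B v"
    using arc_count_insert[OF A'(3,2)] arc_count_insert[OF fin(2) A'(4)]
    by (simp_all only: A'(1)[symmetric])
  have cards: "card A = Suc (card A')" "card (insert v B) = Suc (card B)"
    using card_insert_disjoint[OF A'(3,2)] card_insert_disjoint[OF fin(2) A'(4)]
    by (simp_all only: A'(1)[symmetric])
  have "deg A v = deg A' v"
    using deg_insert_self[of v A'] A'(1) by metis
  moreover have "int (deg A' v) + int d\<^sub>2 \<le> int (deg B v) + int d\<^sub>1"
    using no_gain unfolding split_cost_def A'_def[symmetric] arcs cards
    by (simp add: algebra_simps)
  ultimately show ?thesis using dl deg_Un_disjoint[OF fin, of v] by linarith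
qed

text \<open>
  Lovasz's partition: in a part of minimal cost no vertex can profitably change sides.
\<close>

lemma lovasz_split:
  assumes fin: "finite V" and dl: "\<And>v. v \<in> V \<Longrightarrow> deg V v \<le> d\<^sub>1 + d\<^sub>2 + 1"
  shows "\<exists>A \<subseteq> V. (\<forall>v \<in> A. deg A v \<le> d\<^sub>1) \<and> (\<forall>v \<in> V - A. deg (V - A) v \<le> d\<^sub>2)"
proof -
  let ?cost = "\<lambda>A. split_cost d\<^sub>1 d\<^sub>2 A (V - A)"
  have "\<exists>A \<in> Pow V. \<forall>B \<in> Pow V. ?cost A \<le> ?cost B"
    using ex_min_if_finite[of "?cost ` Pow V"] fin by (auto simp: not_less)
  then obtain A where A: "A \<subseteq> V" and min: "\<And>B. B \<subseteq> V \<Longrightarrow> ?cost A \<le> ?cost B" by blast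
  have finA: "finite A" "finite (V - A)" using A fin by (auto intro: finite_subset)
  have UnA: "A \<union> (V - A) = V" "(V - A) \<union> A = V" using A by auto
  have "deg A v \<le> d\<^sub>1" if v: "v \<in> A" for v
  proof (rule deg_le_if_move_no_gain[OF finA _ v])
    have "V - (A - {v}) = insert v (V - A)" using v A by blast
    then show "?cost A \<le> split_cost d\<^sub>1 d\<^sub>2 (A - {v}) (insert v (V - A))"
      using min[of "A - {v}"] A by auto
  qed (use UnA dl v A in auto)
  moreover have "deg (V - A) v \<le> d\<^sub>2" if v: "v \<in> V - A" for v
  proof (rule deg_le_if_move_no_gain[OF finA(2,1) _ v])
    have "V - insert v A = V - A - {v}" by blast
    then show "split_cost d\<^sub>2 d\<^sub>1 (V - A) A \<le> split_cost d\<^sub>2 d\<^sub>1 (V - A - {v}) (insert v A)"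
      using min[of "insert v A"] A v by (simp add: split_cost_commute[of d\<^sub>2])
    show "deg (V - A \<union> A) v \<le> d\<^sub>2 + d\<^sub>1 + 1" using dl[of v] v by (simp only: UnA) simp
  qed auto
  ultimately show ?thesis using A by (intro exI[of _ A] conjI ballI)
qed

definition colourable :: "nat \<Rightarrow> nat \<Rightarrow> 'a set \<Rightarrow> bool" where
  "colourable m k V \<longleftrightarrow>
    (\<exists>f. (\<forall>v \<in> V. f v < k) \<and> (\<forall>i. degenerate m {v \<in> V. f v = (i :: nat)}))"

lemma colourable_Un:
  assumes "colourable m k A" "colourable m l B" "A \<inter> B = {}"
  shows "colourable m (k + l) (A \<union> B)"
proof -
  obtain f where f: "\<And>v. v \<in> A \<Longrightarrow> f v < k" "\<And>i. degenerate m {v \<in> A. f v = i}"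
    using assms(1) unfolding colourable_def by blast
  obtain g where g: "\<And>v. v \<in> B \<Longrightarrow> g v < l" "\<And>i. degenerate m {v \<in> B. g v = i}"
    using assms(2) unfolding colourable_def by blast
  let ?h = "\<lambda>v. if v \<in> A then f v else k + g v"
  have "degenerate m {v \<in> A \<union> B. ?h v = i}" for i
  proof (cases "i < k")
    case True
    then have "{v \<in> A \<union> B. ?h v = i} \<subseteq> {v \<in> A. f v = i}" by auto
    with f(2) show ?thesis by (rule degenerate_mono)
  next
    case False
    then have "{v \<in> A \<union> B. ?h v = i} \<subseteq> {v \<in> B. g v = i - k}" using f(1) by fastforce
    with g(2) show ?thesis by (rule degenerate_mono)
  qed
  moreover have "?h v < k + l" if "v \<in> A \<union> B" for v
    using that f(1)[of v] g(1)[of v] by auto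
  ultimately show ?thesis unfolding colourable_def by (intro exI[of _ ?h] conjI ballI allI)
qed

lemma colourable_two:
  assumes "0 < m" "finite V" "\<And>v. v \<in> V \<Longrightarrow> deg V v \<le> 4 * m"
  shows "colourable m 2 V"
proof -
  obtain c where c: "\<And>b :: bool. degenerate m {w \<in> V. c w = b}"
    using two_degenerate_classes[OF assms] by blast
  have "degenerate m {v \<in> V. of_bool (c v) = i}" for i :: nat
    by (rule degenerate_mono[OF c[of "i = 1"]]) auto
  then show ?thesis
    unfolding colourable_def by (intro exI[of _ "\<lambda>v. of_bool (c v)"]) auto
qed

text \<open>
  Splitting off a part of degree at most \<open>4 * m\<close> uses two classes and lowers \<open>\<Delta>\<close> by \<open>4 * m + 1\<close>.
  The inner quotient drops by one, so the outer numerator drops by exactly \<open>4 * m\<close> and the bound by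
  exactly two. The remaining case \<open>\<Delta> \<le> 4 * m\<close> needs two classes, or only one if \<open>\<Delta> < 2 * m\<close>.
\<close>

theorem colourable_bound:
  assumes "0 < m" "finite V" "\<And>v. v \<in> V \<Longrightarrow> deg V v \<le> \<Delta>"
  shows "colourable m ((\<Delta> - (\<Delta> + 1) div (4 * m + 1)) div (2 * m) + 1) V"
  using assms(2,3)
proof (induction \<Delta> arbitrary: V rule: less_induct)
  case (less \<Delta>)
  consider "\<Delta> < 2 * m" | "2 * m \<le> \<Delta>" "\<Delta> \<le> 4 * m" | "4 * m + 1 \<le> \<Delta>" by linarith
  then show ?case
  proof cases
    case 1
    then have "degenerate m V"
      using less.prems by (intro degenerate_if_small_deg) (auto intro: le_less_trans)
    then have "degenerate m {v \<in> V. (0 :: nat) = i}" for i by (rule degenerate_mono) auto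
    then have "colourable m 1 V"
      unfolding colourable_def by (intro exI[of _ "\<lambda>_. 0"]) auto
    then show ?thesis using 1 by simp
  next
    case 2
    have "colourable m 2 V" using assms(1) less.prems 2 by (intro colourable_two) (auto intro: order_trans)
    moreover have "(\<Delta> - (\<Delta> + 1) div (4 * m + 1)) div (2 * m) = 1"
    proof (cases "\<Delta> = 4 * m")
      case True
      then have "\<Delta> - (\<Delta> + 1) div (4 * m + 1) = 2 * m + (2 * m - 1)"
        using assms(1) by simp
      then show ?thesis using assms(1) by (simp add: div_nat_eqI)
    next
      case False
      then show ?thesis using 2 assms(1) by (simp add: div_nat_eqI)
    qed
    ultimately show ?thesis by (simp add: numeral_2_eq_2)
  next
    case 3
    define d where "d = \<Delta> - (4 * m + 1)"
    have d: "\<Delta> = 4 * m + d + 1" using 3 by (simp add: d_def)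
    obtain A where A: "A \<subseteq> V" "\<And>v. v \<in> A \<Longrightarrow> deg A v \<le> 4 * m"
      "\<And>v. v \<in> V - A \<Longrightarrow> deg (V - A) v \<le> d"
      using lovasz_split[OF less.prems(1), of "4 * m" d] less.prems(2) d by metis
    have fA: "finite A" "finite (V - A)" using A less.prems(1) by (auto intro: finite_subset)
    have "colourable m 2 A" using colourable_two[OF assms(1) fA(1)] A by blast
    moreover have "colourable m ((d - (d + 1) div (4 * m + 1)) div (2 * m) + 1) (V - A)"
      using less.IH[of d "V - A"] d fA A by simp
    ultimately have "colourable m (2 + ((d - (d + 1) div (4 * m + 1)) div (2 * m) + 1)) (A \<union> (V - A))"
      by (rule colourable_Un) auto
    moreover have "A \<union> (V - A) = V" using A by blast
    moreover have "(\<Delta> - (\<Delta> + 1) div (4 * m + 1)) div (2 * m)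
        = 2 + (d - (d + 1) div (4 * m + 1)) div (2 * m)"
    proof -
      have "(\<Delta> + 1) div (4 * m + 1) = ((d + 1) + (4 * m + 1)) div (4 * m + 1)"
        using d by (simp add: algebra_simps)
      also have "\<dots> = Suc ((d + 1) div (4 * m + 1))" by (subst div_add_self2) auto
      finally have q: "(\<Delta> + 1) div (4 * m + 1) = Suc ((d + 1) div (4 * m + 1))" .
      have "(d + 1) div (4 * m + 1) \<le> (d + 1) div 2"
        using assms(1) by (intro div_le_mono2) auto
      then have "(d + 1) div (4 * m + 1) \<le> d" by linarith
      then have "\<Delta> - (\<Delta> + 1) div (4 * m + 1) = (d - (d + 1) div (4 * m + 1)) + 2 * (2 * m)"
        unfolding q using d by simp
      then show ?thesis using assms(1) by (simp only: div_mult_self1)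
    qed
    ultimately show ?thesis by simp
  qed
qed

end

section \<open>Oriented graphs\<close>

context oriented_graph
begin

sublocale dominates: asymmetric_relation "\<lambda>u v. u \<rightarrow>\<^bsub>G\<^esub> v"
  by unfold_locales (rule no_two_cycle)

text \<open>
  Arcs are counted by \<open>in_degree\<close> and vertices by \<open>preds\<close>; both agree as there are no parallel arcs.
\<close>

lemma degrees_induced:
  assumes "verts H \<subseteq> verts G" "v \<in> verts H"
    and arcs: "arcs H = {e \<in> arcs G. tail G e \<in> verts H \<and> head G e \<in> verts H}"
    and "tail H = tail G" "head H = head G"
  shows "in_degree H v = card (dominates.preds (verts H) v)"
    and "out_degree H v = card (dominates.succs (verts H) v)"
proof -
  have "bij_betw (tail G) (in_arcs H v) (dominates.preds (verts H) v)"
    unfolding bij_betw_def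
  proof
    show "inj_on (tail G) (in_arcs H v)"
      by (rule inj_onI, rule at_most_one_arc) (use assms in auto)
    show "tail G ` in_arcs H v = dominates.preds (verts H) v"
      unfolding dominates.preds_def
      unfolding arcs_ends_def arc_to_ends_def in_arcs_def arcs
      using assms(2,4,5) by auto
  qed
  then show "in_degree H v = card (dominates.preds (verts H) v)"
    by (simp add: in_degree_def bij_betw_same_card)
  have "bij_betw (head G) (out_arcs H v) (dominates.succs (verts H) v)"
    unfolding bij_betw_def
  proof
    show "inj_on (head G) (out_arcs H v)"
      by (rule inj_onI, rule at_most_one_arc) (use assms in auto)
    show "head G ` out_arcs H v = dominates.succs (verts H) v"
      unfolding dominates.succs_def
      unfolding arcs_ends_def arc_to_ends_def out_arcs_def arcs
      using assms(2,4,5) by auto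
  qed
  then show "out_degree H v = card (dominates.succs (verts H) v)"
    by (simp add: out_degree_def bij_betw_same_card)
qed

lemma weakly_degenerate_induce:
  assumes "A \<subseteq> verts G" "dominates.degenerate m A"
  shows "weakly_degenerate m (induce_subgraph G A)"
  unfolding weakly_degenerate_def
proof (intro allI impI)
  fix H assume H: "induced_subgraph H (induce_subgraph G A) \<and> verts H \<noteq> {}"
  then have HA: "verts H \<subseteq> A" by (auto simp: induced_subgraph_def subgraph_def)
  have H': "arcs H = {e \<in> arcs G. tail G e \<in> verts H \<and> head G e \<in> verts H}"
    "tail H = tail G" "head H = head G"
    using H HA by (auto simp: induced_subgraph_def subgraph_def compatible_def)
  obtain v where v: "v \<in> verts H"
    "card (dominates.preds (verts H) v) < m \<or> card (dominates.succs (verts H) v) < m"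
    using assms(2) H HA unfolding dominates.degenerate_def by metis
  then show "\<exists>v \<in> verts H. in_degree H v < m \<or> out_degree H v < m"
    using degrees_induced[OF order_trans[OF HA assms(1)] v(1) H'] by metis
qed

lemma deg_le_max_degree:
  assumes "v \<in> verts G"
  shows "dominates.deg (verts G) v \<le> max_degree G"
proof -
  have "dominates.deg (verts G) v = in_degree G v + out_degree G v"
    unfolding dominates.deg_def using assms
    by (intro arg_cong2[where f = "(+)"] degrees_induced[symmetric]) auto
  then show ?thesis
    using assms unfolding max_degree_def by (intro Max_ge) auto
qed

text \<open>
  Blocks of a partition are nonempty, so unused colours are discarded by taking only the classes
  of colours in the image of \<open>f\<close>.
\<close>

lemma degenerate_chromatic_number_le:
  assumes "dominates.colourable m k (verts G)"
  shows "degenerate_chromatic_number m G \<le> k"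
proof -
  obtain f where f: "\<And>v. v \<in> verts G \<Longrightarrow> f v < k"
    "\<And>i :: nat. dominates.degenerate m {v \<in> verts G. f v = i}"
    using assms unfolding dominates.colourable_def by blast
  let ?A = "\<lambda>i. {v \<in> verts G. f v = i}"
  define P where "P = ?A ` f ` verts G"
  have "partition_on (verts G) P"
    by (auto simp: partition_on_def disjoint_def P_def)
  moreover have "weakly_degenerate m (induce_subgraph G A)" if "A \<in> P" for A
    using that f(2) by (auto simp: P_def intro!: weakly_degenerate_induce)
  ultimately have "degenerate_partition m G P" by (simp add: degenerate_partition_def)
  moreover have "0 < card P" using verts_nonempty by (simp add: P_def card_gt_0_iff)
  ultimately have "degenerate_chromatic_number m G \<le> card P"
    unfolding degenerate_chromatic_number_def by (intro Least_le) blast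
  also have "card P \<le> card (f ` verts G)" unfolding P_def by (intro card_image_le) simp
  also have "\<dots> \<le> card {..<k}" using f(1) by (intro card_mono) auto
  finally show ?thesis by simp
qed

end

theorem theorem1p3:
  fixes D :: "('a, 'b) pre_digraph" and m :: nat
  assumes "0 < m" and "oriented_graph D"
  shows "int (degenerate_chromatic_number m D) \<le>
    \<lfloor>(real (max_degree D) - of_int \<lfloor>(real (max_degree D) + 1) / (4 * real m + 1)\<rfloor>) / (2 * real m)\<rfloor> + 1"
proof -
  interpret oriented_graph D by fact
  let ?\<Delta> = "max_degree D"
  define q where "q = (?\<Delta> + 1) div (4 * m + 1)"
  have "dominates.colourable m ((?\<Delta> - q) div (2 * m) + 1) (verts D)"
    unfolding q_def using assms(1) deg_le_max_degree
    by (intro dominates.colourable_bound) auto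
  then have "degenerate_chromatic_number m D \<le> (?\<Delta> - q) div (2 * m) + 1"
    by (rule degenerate_chromatic_number_le)
  moreover have fl: "\<lfloor>(real ?\<Delta> + 1) / (4 * real m + 1)\<rfloor> = int q"
    using floor_divide_of_nat_eq[of "?\<Delta> + 1" "4 * m + 1", where 'a = real]
    by (simp add: q_def add.commute)
  have "q \<le> (?\<Delta> + 1) div 2" unfolding q_def using assms(1) by (intro div_le_mono2) auto
  then have "q \<le> ?\<Delta>" by linarith
  then have "\<lfloor>(real ?\<Delta> - of_int \<lfloor>(real ?\<Delta> + 1) / (4 * real m + 1)\<rfloor>) / (2 * real m)\<rfloor>
      = int ((?\<Delta> - q) div (2 * m))"
    unfolding fl
    using floor_divide_of_nat_eq[of "?\<Delta> - q" "2 * m", where 'a = real]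
    by simp
  ultimately show ?thesis by simp
qed

end
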